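(* Let $n\geq1$, let $P_n=\{(i,j)\in[n]^2 : i<j\}$ where $[n]=\{0,1,\ldots,n\}$, and let $I\subset P_n$. Let $A_{I,n}$ be the set of total cyclic orders $\pi$ on $[n]$ such that for every $(i,j)\in I$, the tuple $(i,i+1,\ldots,j)$ forms a $\pi$-chain. Let $B_{I,n}$ be the set of all $(x_1,\ldots,x_n)\in[0,1]^n$ such that $x_{i+1}+\cdots+x_j\leq1$ for every $(i,j)\in I$. Then $B_{I,n}$ is a lattice polytope and \[ n!\,\mathrm{vol}(B_{I,n})=\#A_{I,n}. \]
   Context: A cyclic order on a set $X$ is a set $\pi\subset X^3$ satisfying: (i) $(x,y,z)\in\pi\Rightarrow(y,z,x)\in\pi$; (ii) $(x,y,z)\in\pi\Rightarrow(z,y,x)\notin\pi$; (iii) $(x,y,z),(x,z,u)\in\pi\Rightarrow(x,y,u)\in\pi$. It is total if for all distinct $x,y,z$, either $(x,y,z)\in\pi$ or $(z,y,x)\in\pi$. For a total cyclic order $\pi$ on $[n]$ and $m\geq3$, a tuple $(x_1,\ldots,x_m)$ of distinct elements is a $\pi$-chain if $(x_1,x_i,x_{i+1})\in\pi$ for $2\leq i\leq m-1$; every pair of distinct elements is a $\pi$-chain. A lattice polytope is a polytope with all vertices in $\mathbb{Z}^n$; $\mathrm{vol}$ is Lebesgue measure. *)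

theory Defs
  imports "HOL-Analysis.Analysis"
begin

definition cyclic_order_on :: "'a set \<Rightarrow> ('a \<times> 'a \<times> 'a) set \<Rightarrow> bool" where
  "cyclic_order_on X \<pi> \<longleftrightarrow>
     \<pi> \<subseteq> X \<times> X \<times> X \<and>
     (\<forall>x y z. (x, y, z) \<in> \<pi> \<longrightarrow> (y, z, x) \<in> \<pi>) \<and>
     (\<forall>x y z. (x, y, z) \<in> \<pi> \<longrightarrow> (z, y, x) \<notin> \<pi>) \<and>
     (\<forall>x y z u. (x, y, z) \<in> \<pi> \<longrightarrow> (x, z, u) \<in> \<pi> \<longrightarrow> (x, y, u) \<in> \<pi>)"

definition total_cyclic_order_on :: "'a set \<Rightarrow> ('a \<times> 'a \<times> 'a) set \<Rightarrow> bool" where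
  "total_cyclic_order_on X \<pi> \<longleftrightarrow>
     cyclic_order_on X \<pi> \<and>
     (\<forall>x\<in>X. \<forall>y\<in>X. \<forall>z\<in>X. x \<noteq> y \<longrightarrow> y \<noteq> z \<longrightarrow> x \<noteq> z \<longrightarrow>
        (x, y, z) \<in> \<pi> \<or> (z, y, x) \<in> \<pi>)"

text \<open>
  Tuples are lists, so the entry \<open>x\<^sub>i\<close> of a tuple is \<open>xs ! (i - 1)\<close>. For lists of length 2 the
  last condition is vacuous: every pair of distinct elements is a chain.
\<close>

definition cyclic_chain_on :: "'a set \<Rightarrow> ('a \<times> 'a \<times> 'a) set \<Rightarrow> 'a list \<Rightarrow> bool" where
  "cyclic_chain_on X \<pi> xs \<longleftrightarrow>
     2 \<le> length xs \<and> distinct xs \<and> set xs \<subseteq> X \<and>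
     (\<forall>i. 2 \<le> i \<and> i \<le> length xs - 1 \<longrightarrow> (xs ! 0, xs ! (i - 1), xs ! i) \<in> \<pi>)"

definition index_pairs :: "nat \<Rightarrow> (nat \<times> nat) set" where
  "index_pairs n = {(i, j). i \<in> {0..n} \<and> j \<in> {0..n} \<and> i < j}"

definition A_set :: "(nat \<times> nat) set \<Rightarrow> nat \<Rightarrow> (nat \<times> nat \<times> nat) set set" where
  "A_set I n = {\<pi>. total_cyclic_order_on {0..n} \<pi> \<and>
     (\<forall>(i, j)\<in>I. cyclic_chain_on {0..n} \<pi> [i..<Suc j])}"

text \<open>
  The type \<open>real ^ 'n\<close> has no canonical ordering of its coordinates. The map \<open>e\<close>, meant to be a
  bijection from \<open>{1..n}\<close> onto the index type, supplies one: \<open>x\<^sub>k\<close> is \<open>x $ e k\<close>.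
\<close>

definition B_set :: "(nat \<Rightarrow> 'n) \<Rightarrow> (nat \<times> nat) set \<Rightarrow> nat \<Rightarrow> (real ^ 'n::finite) set" where
  "B_set e I n = {x. (\<forall>k\<in>{1..n}. 0 \<le> x $ e k \<and> x $ e k \<le> 1) \<and>
     (\<forall>(i, j)\<in>I. (\<Sum>k = i + 1..j. x $ e k) \<le> 1)}"

definition lattice_polytope :: "(real ^ 'n::finite) set \<Rightarrow> bool" where
  "lattice_polytope S \<longleftrightarrow>
     polytope S \<and> (\<forall>v. v extreme_point_of S \<longrightarrow> (\<forall>i. v $ i \<in> \<int>))"

end

theory Submission
  imports Defs "HOL-Combinatorics.Permutations"
begin

text \<open>
  Put points \<open>y\<^sub>0 = 0, y\<^sub>1, \<dots>, y\<^sub>n\<close> on the circle of length 1, where \<open>x\<^sub>k\<close> is the length of the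
  arc from \<open>y\<^sub>k\<^sub>-\<^sub>1\<close> to \<open>y\<^sub>k\<close>. For generic \<open>x\<close> the points induce a total cyclic order on
  \<open>{0..n}\<close>, and \<open>i, i + 1, \<dots>, j\<close> is a chain exactly if walking from \<open>y\<^sub>i\<close> to \<open>y\<^sub>j\<close> does not go
  around the circle, i.e. if \<open>x\<^sub>i\<^sub>+\<^sub>1 + \<dots> + x\<^sub>j \<le> 1\<close>. Cutting the circle at \<open>y\<^sub>0\<close> identifies cyclic
  orders with permutations \<open>p\<close> of \<open>{1..n}\<close>. On the simplex of all \<open>y\<close> ordered according to \<open>p\<close>
  the map \<open>y \<mapsto> x\<close> is affine with unipotent linear part, so the \<open>x\<close> with a given cyclic order form a
  region of volume \<open>1 / n!\<close>. These regions are disjoint and fill the unit cube up to a null set,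
  and each one lies either inside the polytope or outside of it.
\<close>

section \<open>Measure-preserving coordinate changes\<close>

text \<open>By \<open>measure_linear_sufficient\<close> it is enough to treat boxes. Shears are the
  factors into which the partial-sum map is split below.\<close>

lemma measure_shear_image:
  fixes S :: "(real ^ 'n::finite) set"
  assumes "m \<noteq> k" "S \<in> lmeasurable"
  defines "h \<equiv> \<lambda>x::real^'n. \<chi> i. if i = m then x $ m + x $ k else x $ i"
  shows "h ` S \<in> lmeasurable \<and> measure lebesgue (h ` S) = measure lebesgue S"
proof -
  have lin: "linear h"
    unfolding h_def by (rule linearI) (auto simp: vec_eq_iff algebra_simps)
  have "measure lebesgue (h ` cbox a b) = 1 * measure lebesgue (cbox a b)" for a b
  proof (cases "cbox a b = {}")
    case False
    \<comment> \<open>\<open>measure_shear_interval\<close> needs a box with nonnegative lower bound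
      in direction \<open>k\<close>. Translating by \<open>v\<close> makes that bound 0, and by
      linearity the image is only translated too.\<close>
    define v :: "real^'n" where "v = (\<chi> i. if i = k then - a $ k else 0)"
    have tr: "(+) v ` cbox a b = cbox (v + a) (v + b)"
      by (simp add: cbox_translation)
    have "h ` cbox a b = (+) (- h v) ` h ` (+) v ` cbox a b"
      unfolding image_image by (rule image_cong) (simp_all add: linear_add[OF lin])
    then have "measure lebesgue (h ` cbox a b) = measure lebesgue (h ` cbox (v + a) (v + b))"
      by (simp only: measure_translation tr)
    also have "\<dots> = measure lebesgue (cbox (v + a) (v + b))"
      unfolding h_def
    proof (rule measure_shear_interval[OF assms(1)])
      show "cbox (v + a) (v + b) \<noteq> {}"
        using False unfolding tr[symmetric] by simp
    qed (simp add: v_def)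
    also have "\<dots> = measure lebesgue (cbox a b)"
      unfolding tr[symmetric] by (rule measure_translation)
    finally show ?thesis by simp
  qed simp
  from measure_linear_sufficient[OF lin assms(2) this] show ?thesis
    by simp
qed

text \<open>Boxes go to boxes with the same side lengths in another order. This will give all the
  order simplices the same volume.\<close>

lemma measure_permute_coordinates_image:
  fixes S :: "(real ^ 'n::finite) set" and q :: "'n \<Rightarrow> 'n"
  assumes q: "bij q" and S: "S \<in> lmeasurable"
  defines "h \<equiv> \<lambda>x::real^'n. \<chi> i. x $ q i"
  shows "h ` S \<in> lmeasurable \<and> measure lebesgue (h ` S) = measure lebesgue S"
proof -
  have lin: "linear h"
    unfolding h_def by (rule linearI) (auto simp: vec_eq_iff)
  have inv_h: "h (\<chi> i. x $ inv q i) = x" for x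
    using q by (simp add: h_def vec_eq_iff bij_is_inj)
  have "measure lebesgue (h ` cbox a b) = 1 * measure lebesgue (cbox a b)" for a b
  proof -
    have "h ` cbox a b = cbox (h a) (h b)"
    proof (intro equalityI subsetI)
      fix x assume x: "x \<in> cbox (h a) (h b)"
      have "(\<chi> i. x $ inv q i) \<in> cbox a b"
        unfolding mem_box_cart
      proof
        fix i
        have "h a $ inv q i \<le> x $ inv q i \<and> x $ inv q i \<le> h b $ inv q i"
          using x by (simp add: mem_box_cart)
        then show "a $ i \<le> (\<chi> i. x $ inv q i) $ i \<and> (\<chi> i. x $ inv q i) $ i \<le> b $ i"
          using q by (simp add: h_def bij_is_surj surj_f_inv_f)
      qed
      then show "x \<in> h ` cbox a b"
        by (metis inv_h image_eqI)
    qed (auto simp: mem_box_cart h_def)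
    moreover have "cbox (h a) (h b) = {} \<longleftrightarrow> cbox a b = {}"
      using calculation by (metis image_is_empty)
    moreover have "(\<Prod>i\<in>UNIV. h b $ i - h a $ i) = (\<Prod>i\<in>UNIV. b $ i - a $ i)"
      unfolding h_def using prod.reindex_bij_betw[OF q, of "\<lambda>i. b $ i - a $ i"] by simp
    ultimately show ?thesis
      by (cases "cbox a b = {}") (simp_all add: content_cbox_cart)
  qed
  from measure_linear_sufficient[OF lin S this] show ?thesis
    by simp
qed

section \<open>Total cyclic orders and permutations\<close>

lemma permutes_zero: "p permutes {1..n} \<Longrightarrow> p 0 = (0::nat)"
  by (rule permutes_not_in) auto

lemma permutes_le: "p permutes {1..n} \<Longrightarrow> k \<le> n \<Longrightarrow> p k \<le> (n::nat)"
  using permutes_in_image[of p "{1..n}" k] permutes_zero[of p n]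
  by (cases "k = 0") auto

lemma permutes_pos: "p permutes {1..n} \<Longrightarrow> 0 < k \<Longrightarrow> 0 < p (k::nat)"
  by (metis gr_zeroI permutes_inj permutes_zero inj_eq less_irrefl)

text \<open>Since \<open>p\<close> fixes 0, it also permutes \<open>{0..n}\<close> and maps the
  counted set bijectively onto \<open>{..<p k}\<close>. Hence the order of its values determines the
  permutation.\<close>

lemma permutes_eq_card_less:
  assumes p: "p permutes {1..n::nat}" and k: "k \<le> n"
  shows "p k = card {j. j \<le> n \<and> p j < p k}"
proof -
  have "p ` {j. j \<le> n \<and> p j < p k} = {..<p k}"
  proof (intro equalityI subsetI)
    fix m assume "m \<in> {..<p k}"
    then have m: "m < p k" "m \<le> n"
      using permutes_le[OF p k] by auto
    have "inv p m \<le> n"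
      using permutes_le[OF permutes_inv[OF p] m(2)] .
    moreover have "p (inv p m) = m"
      using p by (simp add: permutes_inverses)
    ultimately show "m \<in> p ` {j. j \<le> n \<and> p j < p k}"
      using m by (metis (mono_tags, lifting) image_eqI mem_Collect_eq)
  qed auto
  then have "card {..<p k} = card {j. j \<le> n \<and> p j < p k}"
    by (metis card_image permutes_inj_on[OF p])
  then show ?thesis by simp
qed

lemma permutes_eqI_less:
  assumes "p permutes {1..n::nat}" "q permutes {1..n}"
    and "\<And>j k. j \<le> n \<Longrightarrow> k \<le> n \<Longrightarrow> p j < p k \<longleftrightarrow> q j < q k"
  shows "p = q"
proof
  fix k show "p k = q k"
  proof (cases "k \<le> n")
    case True
    have "{j. j \<le> n \<and> p j < p k} = {j. j \<le> n \<and> q j < q k}"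
      using assms(3) True by auto
    then show ?thesis
      using permutes_eq_card_less assms(1,2) True by metis
  next
    case False
    then show ?thesis
      using assms(1,2) by (simp add: permutes_not_in)
  qed
qed

lemma ex_permutes_rank:
  fixes R :: "nat \<Rightarrow> nat \<Rightarrow> bool"
  assumes irr: "\<And>j. j \<in> {1..n} \<Longrightarrow> \<not> R j j"
    and trans: "\<And>i j k. i \<in> {1..n} \<Longrightarrow> j \<in> {1..n} \<Longrightarrow> k \<in> {1..n} \<Longrightarrow> R i j \<Longrightarrow> R j k \<Longrightarrow> R i k"
    and total: "\<And>j k. j \<in> {1..n} \<Longrightarrow> k \<in> {1..n} \<Longrightarrow> j \<noteq> k \<Longrightarrow> R j k \<or> R k j"
  obtains p where "p permutes {1..n}" "\<And>j k. j \<in> {1..n} \<Longrightarrow> k \<in> {1..n} \<Longrightarrow> R j k \<longleftrightarrow> p j < p k"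
proof
  \<comment> \<open>The rank in the order \<open>R\<close>: \<open>Suc\<close> gives the least
    element rank 1, and points outside \<open>{1..n}\<close> stay fixed as \<open>permutes\<close>
    demands.\<close>
  define p where "p k = (if k \<in> {1..n} then Suc (card {j\<in>{1..n}. R j k}) else k)" for k
  have mono: "p j < p k" if "j \<in> {1..n}" "k \<in> {1..n}" "R j k" for j k
  proof -
    have "{i\<in>{1..n}. R i j} \<subset> {i\<in>{1..n}. R i k}"
      using that trans irr by blast
    then have "card {i\<in>{1..n}. R i j} < card {i\<in>{1..n}. R i k}"
      by (intro psubset_card_mono) auto
    then show ?thesis
      using that by (simp add: p_def)
  qed
  show less: "R j k \<longleftrightarrow> p j < p k" if "j \<in> {1..n}" "k \<in> {1..n}" for j k
    using mono that total by (metis less_asym less_irrefl)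
  have inj: "inj_on p {1..n}"
    using mono total by (intro inj_onI) (metis less_irrefl)
  have "p k \<in> {1..n}" if "k \<in> {1..n}" for k
  proof -
    have "{j\<in>{1..n}. R j k} \<subset> {1..n}"
      using that irr by blast
    from psubset_card_mono[OF finite_atLeastAtMost this] have "card {j\<in>{1..n}. R j k} < n"
      by simp
    then show ?thesis
      using that by (simp add: p_def)
  qed
  then have "p ` {1..n} = {1..n}"
    using inj by (intro endo_inj_surj) auto
  then show "p permutes {1..n}"
    using inj by (intro bij_imp_permutes) (auto simp: bij_betw_def p_def)
qed

section \<open>Cyclic orders described by ranks\<close>

definition cyc3 :: "'a::linorder \<Rightarrow> 'a \<Rightarrow> 'a \<Rightarrow> bool" where
  "cyc3 a b c \<longleftrightarrow> a < b \<and> b < c \<or> b < c \<and> c < a \<or> c < a \<and> a < b"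

text \<open>\<open>p k\<close> is the rank of the point \<open>k\<close> once the circle is cut open
  at 0; a permutation of \<open>{1..n}\<close> fixes 0, so 0 comes first. \<open>cyc3\<close> is
  polymorphic so that it also applies to real positions.\<close>

definition cyc_of :: "nat \<Rightarrow> (nat \<Rightarrow> nat) \<Rightarrow> (nat \<times> nat \<times> nat) set" where
  "cyc_of n p = {(a, b, c). a \<le> n \<and> b \<le> n \<and> c \<le> n \<and> cyc3 (p a) (p b) (p c)}"

lemma total_cyclic_order_cyc_of:
  assumes "p permutes {1..n}"
  shows "total_cyclic_order_on {0..n} (cyc_of n p)"
proof -
  have "p x \<noteq> p y" if "x \<noteq> y" for x y
    using permutes_inj[OF assms] that by (auto dest: injD)
  then show ?thesis
    unfolding total_cyclic_order_on_def cyclic_order_on_def cyc_of_def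
    by (auto simp: cyc3_def) (metis linorder_neqE_nat)+
qed

lemma inj_on_cyc_of: "inj_on (cyc_of n) {p. p permutes {1..n}}"
proof (rule inj_onI, clarify)
  fix p q assume p: "p permutes {1..n}" and q: "q permutes {1..n}" and eq: "cyc_of n p = cyc_of n q"
  \<comment> \<open>As 0 has the least rank, the triples that begin with 0 record the order of all
    the other ranks.\<close>
  have less: "r j < r k \<longleftrightarrow> 0 < k \<and> (j = 0 \<or> (0, j, k) \<in> cyc_of n r)"
    if "r permutes {1..n}" "j \<le> n" "k \<le> n" for r j k
    using that permutes_pos[OF that(1)] permutes_zero[OF that(1)]
    by (cases "k = 0"; cases "j = 0") (auto simp: cyc_of_def cyc3_def)
  show "p = q"
    using p q eq by (intro permutes_eqI_less[of p n q]) (auto simp: less)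
qed

text \<open>With 0 fixed as first entry, \<open>\<pi>\<close> becomes a strict linear order on
  \<open>{1..n}\<close>, and its rank function is the permutation.\<close>

lemma ex_permutes_cyc_of:
  assumes \<pi>: "total_cyclic_order_on {0..n} \<pi>"
  obtains p where "p permutes {1..n}" "cyc_of n p = \<pi>"
proof -
  have sub: "\<pi> \<subseteq> {0..n} \<times> {0..n} \<times> {0..n}"
    and rot: "\<And>x y z. (x, y, z) \<in> \<pi> \<Longrightarrow> (y, z, x) \<in> \<pi>"
    and asym: "\<And>x y z. (x, y, z) \<in> \<pi> \<Longrightarrow> (z, y, x) \<notin> \<pi>"
    and trans: "\<And>x y z u. (x, y, z) \<in> \<pi> \<Longrightarrow> (x, z, u) \<in> \<pi> \<Longrightarrow> (x, y, u) \<in> \<pi>"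
    using \<pi> unfolding total_cyclic_order_on_def cyclic_order_on_def by blast+
  have tot: "\<And>x y z. x \<le> n \<Longrightarrow> y \<le> n \<Longrightarrow> z \<le> n \<Longrightarrow> x \<noteq> y \<Longrightarrow> y \<noteq> z \<Longrightarrow> x \<noteq> z \<Longrightarrow>
        (x, y, z) \<in> \<pi> \<or> (z, y, x) \<in> \<pi>"
    using \<pi> unfolding total_cyclic_order_on_def by simp
  have dist: "x \<noteq> y \<and> y \<noteq> z \<and> x \<noteq> z" if "(x, y, z) \<in> \<pi>" for x y z
    using that rot asym by metis
  obtain p where p: "p permutes {1..n}"
    and less: "\<And>j k. j \<in> {1..n} \<Longrightarrow> k \<in> {1..n} \<Longrightarrow> (0, j, k) \<in> \<pi> \<longleftrightarrow> p j < p k"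
  proof (rule ex_permutes_rank[of n "\<lambda>j k. (0, j, k) \<in> \<pi>"])
    show "\<And>j. (0, j, j) \<notin> \<pi>" using dist by blast
    show "\<And>i j k. (0, i, j) \<in> \<pi> \<Longrightarrow> (0, j, k) \<in> \<pi> \<Longrightarrow> (0, i, k) \<in> \<pi>" using trans by blast
    fix j k assume "j \<in> {1..n}" "k \<in> {1..n}" "j \<noteq> k"
    then have "(0, j, k) \<in> \<pi> \<or> (k, j, 0) \<in> \<pi>" by (intro tot) auto
    then show "(0, j, k) \<in> \<pi> \<or> (0, k, j) \<in> \<pi>" using rot by blast
  qed blast
  have incr: "(a, b, c) \<in> \<pi>" if "a \<le> n" "b \<le> n" "c \<le> n" "p a < p b" "p b < p c" for a b c
  proof -
    have b: "b \<in> {1..n}" and c: "c \<in> {1..n}"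
      using that permutes_zero[OF p] by (auto intro!: Suc_leI gr0I)
    have bc: "(0, b, c) \<in> \<pi>"
      using that less[OF b c] by blast
    show ?thesis
    proof (cases "a = 0")
      case False
      then have "(0, a, b) \<in> \<pi>"
        using that less[OF _ b] by auto
      \<comment> \<open>Transitivity with base point \<open>b\<close> turns \<open>(b, c, 0)\<close>
        and \<open>(b, 0, a)\<close> into \<open>(b, c, a)\<close>, a rotation of the goal.\<close>
      then have "(b, 0, a) \<in> \<pi>" "(b, c, 0) \<in> \<pi>"
        using rot bc by blast+
      then show ?thesis
        using trans rot by blast
    qed (use bc in simp)
  qed
  have sub1: "cyc_of n p \<subseteq> \<pi>"
    using incr rot unfolding cyc_of_def cyc3_def by blast
  \<comment> \<open>Totality of \<open>cyc_of n p\<close> and asymmetry of \<open>\<pi>\<close>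
    upgrade the inclusion to an equality.\<close>
  have "t \<in> cyc_of n p" if t: "t \<in> \<pi>" for t
  proof -
    obtain a b c where t_eq: "t = (a, b, c)"
      by (cases t)
    have le: "a \<le> n" "b \<le> n" "c \<le> n"
      using sub t t_eq by auto
    have "(a, b, c) \<in> cyc_of n p \<or> (c, b, a) \<in> cyc_of n p"
      using total_cyclic_order_cyc_of[OF p] le dist[of a b c] t t_eq
      unfolding total_cyclic_order_on_def by (metis atLeastAtMost_iff zero_le)
    then show ?thesis
      using asym sub1 t t_eq by blast
  qed
  with sub1 have "cyc_of n p = \<pi>" by blast
  with p show thesis by (rule that)
qed

lemma cyclic_chain_on_cyc_of_iff:
  assumes p: "p permutes {1..n}" and ij: "i < j" "j \<le> n"
  shows "cyclic_chain_on {0..n} (cyc_of n p) [i..<Suc j] \<longleftrightarrow>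
    (\<forall>k. i < k \<and> k < j \<longrightarrow> cyc3 (p i) (p k) (p (Suc k)))" (is "?L \<longleftrightarrow> ?R")
proof -
  \<comment> \<open>The list entries at positions \<open>m - 1\<close> and \<open>m\<close> are
    \<open>k\<close> and \<open>Suc k\<close> for \<open>k = i + (m - 1)\<close>.\<close>
  have *: "?L \<longleftrightarrow> (\<forall>m. 2 \<le> m \<and> m \<le> j - i \<longrightarrow> cyc3 (p i) (p (i + (m - 1))) (p (i + m)))"
    using ij by (auto simp: cyclic_chain_on_def cyc_of_def nth_upt simp del: upt_Suc)
  show ?thesis
  proof
    assume L: ?L
    show ?R
    proof (intro allI impI)
      fix k assume k: "i < k \<and> k < j"
      then have "cyc3 (p i) (p (i + (Suc k - i - 1))) (p (i + (Suc k - i)))"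
        using L unfolding * by (metis Suc_diff_le Suc_leI diff_le_mono less_imp_le_nat
            numeral_2_eq_2 Suc_le_mono zero_less_diff)
      then show "cyc3 (p i) (p k) (p (Suc k))"
        using k by simp
    qed
  next
    assume R: ?R
    show ?L
      unfolding *
    proof (intro allI impI)
      fix m assume m: "2 \<le> m \<and> m \<le> j - i"
      then have "i < i + (m - 1) \<and> i + (m - 1) < j"
        by auto
      then have "cyc3 (p i) (p (i + (m - 1))) (p (Suc (i + (m - 1))))"
        using R by blast
      moreover have "Suc (i + (m - 1)) = i + m"
        using m by simp
      ultimately show "cyc3 (p i) (p (i + (m - 1))) (p (i + m))"
        by simp
    qed
  qed
qed

section \<open>Partial sums of coordinates\<close>

locale coordinate_enumeration =
  fixes e :: "nat \<Rightarrow> 'n::finite" and n :: nat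
  assumes bij_e: "bij_betw e {1..n} UNIV"
begin

definition idx :: "'n \<Rightarrow> nat" where
  "idx = inv_into {1..n} e"

lemma idx_e [simp]: "0 < k \<Longrightarrow> k \<le> n \<Longrightarrow> idx (e k) = k"
  unfolding idx_def using bij_betw_inv_into_left[OF bij_e, of k] by simp

lemma e_idx [simp]: "e (idx i) = i"
  unfolding idx_def using bij_betw_inv_into_right[OF bij_e, of i] by simp

lemma idx_pos [simp]: "0 < idx i" and idx_le [simp]: "idx i \<le> n"
  using bij_betw_apply[OF bij_betw_inv_into[OF bij_e], of i] by (auto simp: idx_def)

lemma idx_neq_0 [simp]: "idx i \<noteq> 0"
  by simp

lemma all_idx_iff: "(\<forall>i. P i) \<longleftrightarrow> (\<forall>k\<in>{1..n}. P (e k))"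
  by (metis atLeastAtMost_iff e_idx idx_le idx_pos One_nat_def Suc_leI)

text \<open>The position of point \<open>k\<close> on the circle, with point 0 pinned at 0;
  \<open>e\<close> enumerates coordinates from 1 on only.\<close>

definition crd :: "real ^ 'n \<Rightarrow> nat \<Rightarrow> real" where
  "crd y k = (if k = 0 then 0 else y $ e k)"

definition psum :: "real ^ 'n \<Rightarrow> nat \<Rightarrow> real" where
  "psum x m = (\<Sum>k = 1..m. x $ e k)"

definition sumv :: "real ^ 'n \<Rightarrow> real ^ 'n" where
  "sumv x = (\<chi> i. psum x (idx i))"

text \<open>The inverse of \<open>sumv\<close>, leading from positions back to signed steps. As
  \<open>idx i\<close> is positive, the natural subtraction does not truncate, and the first step
  starts at the pinned point.\<close>

definition diffv :: "real ^ 'n \<Rightarrow> real ^ 'n" where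
  "diffv y = (\<chi> i. crd y (idx i) - crd y (idx i - 1))"

lemma psum_0 [simp]: "psum x 0 = 0"
  by (simp add: psum_def)

lemma psum_Suc: "psum x (Suc m) = psum x m + x $ e (Suc m)"
  by (simp add: psum_def)

lemma psum_add: "psum (x + y) m = psum x m + psum y m"
  by (simp add: psum_def sum.distrib)

lemma psum_scaleR: "psum (c *\<^sub>R x) m = c * psum x m"
  by (simp add: psum_def sum_distrib_left)

lemma component_eq_psum: "0 < k \<Longrightarrow> x $ e k = psum x k - psum x (k - 1)"
  by (cases k) (simp_all add: psum_Suc)

lemma sum_eq_psum: "i \<le> j \<Longrightarrow> (\<Sum>k = i + 1..j. x $ e k) = psum x j - psum x i"
proof (induction j rule: dec_induct)
  case (step j)
  then show ?case by (simp add: psum_Suc)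
qed simp

lemma linear_sumv: "linear sumv"
  by (rule linearI) (simp_all add: sumv_def vec_eq_iff psum_add psum_scaleR)

lemma linear_diffv: "linear diffv"
  by (rule linearI) (simp_all add: diffv_def crd_def vec_eq_iff algebra_simps)

lemma psum_diffv: "k \<le> n \<Longrightarrow> psum (diffv y) k = crd y k"
proof (induction k)
  case (Suc k)
  then show ?case by (simp add: psum_Suc diffv_def)
qed (simp add: crd_def)

lemma sumv_diffv [simp]: "sumv (diffv y) = y"
  by (simp add: sumv_def vec_eq_iff psum_diffv) (simp add: crd_def)

lemma diffv_sumv [simp]: "diffv (sumv x) = x"
proof -
  have "crd (sumv x) k = psum x k" if "k \<le> n" for k
    using that by (simp add: crd_def sumv_def)
  moreover have "idx i - 1 \<le> n" for i
    using idx_le[of i] by linarith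
  moreover have "psum x (idx i) - psum x (idx i - 1) = x $ i" for i
    using component_eq_psum[OF idx_pos, of x i] by simp
  ultimately show ?thesis
    by (simp add: diffv_def vec_eq_iff)
qed

text \<open>The map is a product of shears. In \<open>h m\<close> the first \<open>m\<close>
  coordinates are already summed; passing to \<open>Suc m\<close> adds coordinate \<open>m\<close>,
  by then a partial sum, to coordinate \<open>Suc m\<close>.\<close>

lemma measure_sumv_image:
  assumes S: "S \<in> lmeasurable"
  shows "sumv ` S \<in> lmeasurable \<and> measure lebesgue (sumv ` S) = measure lebesgue S"
proof -
  define h where "h m x = (\<chi> i. if idx i \<le> m then psum x (idx i) else x $ i)" for m x
  have "h m ` S \<in> lmeasurable \<and> measure lebesgue (h m ` S) = measure lebesgue S" if "m \<le> n" for m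
    using that
  proof (induction m)
    case 0
    have "h 0 = id"
      by (auto simp: h_def fun_eq_iff vec_eq_iff)
    then show ?case using S by simp
  next
    case (Suc m)
    show ?case
    proof (cases "m = 0")
      \<comment> \<open>The first partial sum is the first coordinate itself, so this step is the
        identity instead of a shear.\<close>
      case True
      have "psum x (idx i) = x $ i" if "idx i \<le> Suc 0" for x i
      proof -
        have "idx i = Suc 0"
          using that idx_pos[of i] by linarith
        then show ?thesis
          using e_idx[of i] by (simp add: psum_def)
      qed
      then have "h (Suc m) = id"
        using True by (auto simp: h_def fun_eq_iff vec_eq_iff)
      then show ?thesis using S by simp
    next
      case False
      have ne: "e (Suc m) \<noteq> e m"
        using False Suc.prems by (metis Suc_leD idx_e n_not_Suc_n neq0_conv zero_less_Suc)
      have "h (Suc m) x =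
          (\<chi> i. if i = e (Suc m) then h m x $ e (Suc m) + h m x $ e m else h m x $ i)" for x
      proof -
        have "i = e (Suc m) \<longleftrightarrow> idx i = Suc m" for i
          using Suc.prems by (metis e_idx idx_e zero_less_Suc)
        then show ?thesis
          using False Suc.prems by (auto simp: h_def vec_eq_iff psum_Suc le_Suc_eq)
      qed
      then have "h (Suc m) ` S =
          (\<lambda>x. \<chi> i. if i = e (Suc m) then x $ e (Suc m) + x $ e m else x $ i) ` h m ` S"
        by (simp add: image_image)
      then show ?thesis
        using measure_shear_image[OF ne] Suc by simp
    qed
  qed
  from this[of n] show ?thesis
    by (simp add: h_def sumv_def[abs_def])
qed

text \<open>\<open>measure_sumv_image\<close> can be read backwards once the image under
  \<open>diffv\<close> is known to be measurable. It is bounded, and open as the preimage of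
  \<open>S\<close> under the continuous map \<open>sumv\<close>.\<close>

lemma measure_diffv_image:
  assumes S: "bounded S" "open S"
  shows "diffv ` S \<in> lmeasurable \<and> measure lebesgue (diffv ` S) = measure lebesgue S"
proof -
  have "diffv ` S = sumv -` S"
    by (auto simp: image_iff) (metis diffv_sumv)
  then have "open (diffv ` S)"
    using S(2) linear_continuous_on[OF linear_sumv[unfolded linear_conv_bounded_linear], of UNIV]
    by (simp add: open_vimage)
  moreover have "bounded (diffv ` S)"
    using S(1) linear_diffv by (simp add: bounded_linear_image linear_conv_bounded_linear)
  ultimately have *: "diffv ` S \<in> lmeasurable"
    by (simp add: lmeasurable_open)
  have "sumv ` diffv ` S = S"
    by (simp add: image_image)
  then show ?thesis
    using measure_sumv_image[OF *] * by simp
qed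

section \<open>The lattice polytope\<close>

text \<open>Every constraint becomes a bound on a difference of two partial sums, the form used both
  for the vertices and for the chain criterion.\<close>

lemma B_set_iff_psum:
  assumes "I \<subseteq> index_pairs n"
  shows "x \<in> B_set e I n \<longleftrightarrow>
    (\<forall>k\<in>{1..n}. 0 \<le> psum x k - psum x (k - 1) \<and> psum x k - psum x (k - 1) \<le> 1) \<and>
    (\<forall>(i, j)\<in>I. psum x j - psum x i \<le> 1)"
proof -
  have "(\<forall>(i, j)\<in>I. (\<Sum>k = i + 1..j. x $ e k) \<le> 1) \<longleftrightarrow> (\<forall>(i, j)\<in>I. psum x j - psum x i \<le> 1)"
  proof (intro ball_cong refl, clarify)
    fix i j assume "(i, j) \<in> I"
    then have "i \<le> j"
      using assms by (auto simp: index_pairs_def)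
    then show "(\<Sum>k = i + 1..j. x $ e k) \<le> 1 \<longleftrightarrow> psum x j - psum x i \<le> 1"
      by (simp only: sum_eq_psum)
  qed
  moreover have "x $ e k = psum x k - psum x (k - 1)" if "k \<in> {1..n}" for k
    using that by (intro component_eq_psum) simp
  ultimately show ?thesis
    unfolding B_set_def by simp
qed

lemma unit_cube_eq_cbox: "B_set e {} n = cbox 0 (\<chi> i. 1)"
proof -
  have "x \<in> B_set e {} n \<longleftrightarrow> (\<forall>i. 0 \<le> x $ i \<and> x $ i \<le> 1)" for x
    unfolding B_set_def all_idx_iff[of "\<lambda>i. 0 \<le> x $ i \<and> x $ i \<le> 1"] by simp
  then show ?thesis
    by (auto simp: mem_box_cart)
qed

lemma B_set_subset_cube: "B_set e I n \<subseteq> B_set e {} n"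
  by (auto simp: B_set_def)

lemma polytope_B_set:
  assumes "finite I"
  shows "polytope (B_set e I n)"
proof -
  have eq: "B_set e I n = B_set e {} n \<inter>
      (\<Inter>(i, j)\<in>I. {x. (\<Sum>k = i + 1..j. axis (e k) 1) \<bullet> x \<le> 1})"
    by (auto simp: B_set_def inner_sum_left inner_axis')
  have "polyhedron (B_set e I n)"
    unfolding eq
  proof (intro polyhedron_Int polyhedron_Inter)
    show "polyhedron (B_set e {} n)"
      by (simp add: unit_cube_eq_cbox polytope_imp_polyhedron)
  qed (use assms in \<open>auto simp: polyhedron_halfspace_le\<close>)
  moreover have "bounded (B_set e I n)"
    using B_set_subset_cube bounded_cbox unfolding unit_cube_eq_cbox by (rule bounded_subset[rotated])
  ultimately show ?thesis
    by (simp add: polytope_eq_bounded_polyhedron)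
qed

text \<open>
  If some partial sum of \<open>v\<close> is not an integer, then all partial sums with the same fractional part
  can be shifted simultaneously by \<open>\<plusminus>\<epsilon>\<close>: every defining inequality compares the difference of two
  partial sums with 0 or 1, and only non-integral differences, where it is strict, are changed.
\<close>

lemma extreme_point_B_set_integral:
  assumes I: "I \<subseteq> index_pairs n" and v: "v extreme_point_of (B_set e I n)"
  shows "v $ i \<in> \<int>"
proof -
  have psum_int: "psum v m \<in> \<int>" if "m \<le> n" for m
  proof (rule ccontr)
    assume m: "psum v m \<notin> \<int>"
    define K where "K = {k. k \<le> n \<and> frac (psum v k) = frac (psum v m)}"
    \<comment> \<open>\<open>w\<close> is built to have the indicator of \<open>K\<close> as its
      partial sums. This is consistent at index 0, where partial sums vanish: 0 is not in
      \<open>K\<close> because \<open>psum v m\<close> is not an integer.\<close>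
    define w where "w = diffv (\<chi> i. of_bool (idx i \<in> K))"
    have "0 \<notin> K" "m \<in> K"
      using m that by (auto simp: K_def)
    then have psum_w: "psum w k = of_bool (k \<in> K)" if "k \<le> n" for k
      using that by (simp add: w_def psum_diffv) (simp add: crd_def)
    define F where "F = (\<lambda>(i, j). psum v j - psum v i) ` ({..n} \<times> {..n}) - \<int>"
    \<comment> \<open>The least distance from a non-integral difference to the integers below and
      above it; the extra 1 keeps the set nonempty when \<open>F\<close> is empty.\<close>
    define \<epsilon> where "\<epsilon> = Min (insert 1 (frac ` F \<union> (\<lambda>D. 1 - frac D) ` F))"
    have F: "finite F" by (simp add: F_def)
    have "\<epsilon> \<in> insert 1 (frac ` F \<union> (\<lambda>D. 1 - frac D) ` F)"
      unfolding \<epsilon>_def by (rule Min_in) (use F in auto)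
    then have \<epsilon>: "\<epsilon> > 0"
      by (auto simp: F_def frac_gt_0_iff frac_lt_1)
    have \<epsilon>_le: "\<epsilon> \<le> frac D" "\<epsilon> \<le> 1 - frac D" if "D \<in> F" for D
      unfolding \<epsilon>_def using F that by (auto intro!: Min_le)
    have shift: "(psum v j - psum v i \<le> 1 \<longrightarrow> psum (v + s *\<^sub>R w) j - psum (v + s *\<^sub>R w) i \<le> 1) \<and>
        (0 \<le> psum v j - psum v i \<longrightarrow> 0 \<le> psum (v + s *\<^sub>R w) j - psum (v + s *\<^sub>R w) i)"
      if "i \<le> n" "j \<le> n" "s = \<epsilon> \<or> s = - \<epsilon>" for i j s
    proof (cases "psum v j - psum v i \<in> \<int>")
      case True
      then have "(psum v j - psum v i) + of_int \<lfloor>psum v i\<rfloor> \<in> \<int>"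
        by (rule Ints_add) simp
      also have "(psum v j - psum v i) + of_int \<lfloor>psum v i\<rfloor> = psum v j - frac (psum v i)"
        by (simp add: frac_def)
      finally have "frac (psum v j) = frac (psum v i)"
        by (simp add: frac_unique_iff frac_lt_1)
      then have "j \<in> K \<longleftrightarrow> i \<in> K"
        using that by (simp add: K_def)
      then show ?thesis
        using that by (simp add: psum_add psum_scaleR psum_w)
    next
      case False
      define D where "D = psum v j - psum v i"
      have "D \<in> F"
        using that False by (auto simp: F_def D_def)
      note le = \<epsilon>_le[OF this]
      have "D \<noteq> 1" using False by (auto simp: D_def)
      have up: "D + \<epsilon> \<le> 1" if "D \<le> 1"
      proof -
        have "real_of_int \<lfloor>D\<rfloor> \<le> 0"
          using that \<open>D \<noteq> 1\<close> by simp
        then show ?thesis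
          using le(2) unfolding frac_def by linarith
      qed
      have lo: "0 \<le> D - \<epsilon>" if "0 \<le> D"
      proof -
        have "0 \<le> real_of_int \<lfloor>D\<rfloor>"
          using that by simp
        then show ?thesis
          using le(1) unfolding frac_def by linarith
      qed
      have "\<bar>s * psum w j - s * psum w i\<bar> \<le> \<epsilon>"
        using that \<epsilon> by (auto simp: psum_w)
      moreover have "psum (v + s *\<^sub>R w) j - psum (v + s *\<^sub>R w) i = D + (s * psum w j - s * psum w i)"
        by (simp add: psum_add psum_scaleR D_def)
      ultimately show ?thesis
        using up lo unfolding D_def[symmetric] by linarith
    qed
    have vB: "v \<in> B_set e I n"
      using v by (simp add: extreme_point_of_def)
    have inB: "v + s *\<^sub>R w \<in> B_set e I n" if "s = \<epsilon> \<or> s = - \<epsilon>" for s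
      unfolding B_set_iff_psum[OF I]
    proof (intro conjI ballI)
      fix k assume k: "k \<in> {1..n}"
      then have "k - 1 \<le> n" "k \<le> n" by auto
      note shift = shift[OF this that]
      have "0 \<le> psum v k - psum v (k - 1)" "psum v k - psum v (k - 1) \<le> 1"
        using vB k unfolding B_set_iff_psum[OF I] by auto
      then show "0 \<le> psum (v + s *\<^sub>R w) k - psum (v + s *\<^sub>R w) (k - 1)"
        and "psum (v + s *\<^sub>R w) k - psum (v + s *\<^sub>R w) (k - 1) \<le> 1"
        using shift by blast+
    next
      fix ij assume ij: "ij \<in> I"
      obtain i j where [simp]: "ij = (i, j)" by (cases ij)
      have "i \<le> n" "j \<le> n"
        using ij I by (auto simp: index_pairs_def)
      moreover have "psum v j - psum v i \<le> 1"
        using vB ij unfolding B_set_iff_psum[OF I] by auto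
      ultimately show "case ij of (i, j) \<Rightarrow> psum (v + s *\<^sub>R w) j - psum (v + s *\<^sub>R w) i \<le> 1"
        using shift that by simp
    qed
    have "w \<noteq> 0"
      using psum_w[OF \<open>m \<le> n\<close>] \<open>m \<in> K\<close> by (auto simp: psum_def)
    then have "v + \<epsilon> *\<^sub>R w \<noteq> v + (- \<epsilon>) *\<^sub>R w"
      using \<epsilon> by (simp add: algebra_simps flip: scaleR_2)
    moreover have "midpoint (v + \<epsilon> *\<^sub>R w) (v + (- \<epsilon>) *\<^sub>R w) = v"
      by (simp add: midpoint_def flip: scaleR_2)
    ultimately have "v \<in> open_segment (v + \<epsilon> *\<^sub>R w) (v + (- \<epsilon>) *\<^sub>R w)"
      by (metis midpoint_in_open_segment)
    then show False
      using v inB unfolding extreme_point_of_def by blast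
  qed
  have "v $ e (idx i) = psum v (idx i) - psum v (idx i - 1)"
    by (rule component_eq_psum) simp
  moreover have "idx i - 1 \<le> n"
    using idx_le[of i] by linarith
  ultimately show ?thesis
    using psum_int by simp
qed

section \<open>The alcoves of the unit cube\<close>

text \<open>An open order simplex. Index 0 takes part in the comparisons, so
  \<open>crd y 0 = 0\<close> yields positivity when \<open>p\<close> permutes \<open>{1..n}\<close>;
  only the upper bound 1 has to be imposed separately.\<close>

definition Delta :: "(nat \<Rightarrow> nat) \<Rightarrow> (real ^ 'n) set" where
  "Delta p = {y. (\<forall>k\<in>{1..n}. y $ e k < 1) \<and>
     (\<forall>j\<in>{..n}. \<forall>k\<in>{..n}. p j < p k \<longrightarrow> crd y j < crd y k)}"

lemma Delta_less_iff:
  assumes p: "p permutes {1..n}" and y: "y \<in> Delta p" and "j \<le> n" "k \<le> n"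
  shows "crd y j < crd y k \<longleftrightarrow> p j < p k"
proof (cases "j = k")
  case False
  then have "p j \<noteq> p k"
    using permutes_inj[OF p] by (auto dest: injD)
  then show ?thesis
    using y assms(3,4) unfolding Delta_def
    by (metis (mono_tags, lifting) atMost_iff linorder_neqE_nat mem_Collect_eq order_less_asym)
qed simp

lemma crd_0 [simp]: "crd y 0 = 0"
  by (simp add: crd_def)

lemma Delta_range:
  assumes p: "p permutes {1..n}" and y: "y \<in> Delta p" and k: "k \<le> n"
  shows "0 \<le> crd y k" "crd y k < 1"
proof -
  show "0 \<le> crd y k"
    using Delta_less_iff[OF p y k, of 0] permutes_zero[OF p] by simp
  show "crd y k < 1"
    using y k by (auto simp: Delta_def crd_def)
qed

lemma Delta_disjoint:
  assumes "p permutes {1..n}" "q permutes {1..n}" "y \<in> Delta p" "y \<in> Delta q"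
  shows "p = q"
  using assms by (intro permutes_eqI_less[of p n q]) (metis Delta_less_iff)+

lemma Delta_subset_cube:
  assumes p: "p permutes {1..n}"
  shows "Delta p \<subseteq> B_set e {} n"
proof
  fix y assume y: "y \<in> Delta p"
  have "0 \<le> y $ e k \<and> y $ e k \<le> 1" if "k \<in> {1..n}" for k
    using Delta_range[OF p y, of k] that by (auto simp: crd_def)
  then show "y \<in> B_set e {} n"
    by (simp add: B_set_def)
qed

lemma bounded_Delta: "p permutes {1..n} \<Longrightarrow> bounded (Delta p)"
  using Delta_subset_cube bounded_cbox unfolding unit_cube_eq_cbox by (rule bounded_subset[rotated])

lemma open_Delta: "open (Delta p)"
proof -
  have cont: "continuous_on UNIV (\<lambda>y. crd y k)" for k
    by (cases "k = 0") (auto simp: crd_def intro!: continuous_intros)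
  have "Delta p = (\<Inter>k\<in>{1..n}. {y. y $ e k < 1}) \<inter>
      (\<Inter>(j, k)\<in>{(j, k). (j, k) \<in> {..n} \<times> {..n} \<and> p j < p k}. {y. crd y j < crd y k})"
    unfolding Delta_def by blast
  moreover have "finite {(j, k). (j, k) \<in> {..n} \<times> {..n} \<and> p j < p k}"
    by (rule finite_subset[of _ "{..n} \<times> {..n}"]) auto
  ultimately show ?thesis
    by (auto intro!: open_Int open_INT open_Collect_less cont continuous_intros)
qed

lemma lmeasurable_Delta: "p permutes {1..n} \<Longrightarrow> Delta p \<in> lmeasurable"
  by (simp add: lmeasurable_open bounded_Delta open_Delta)

lemma measure_Delta_eq:
  assumes p: "p permutes {1..n}"
  shows "measure lebesgue (Delta p) = measure lebesgue (Delta id)"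
proof -
  define h where "h p y = (\<chi> i. y $ e (p (idx i)))" for p and y :: "real^'n"
  have crd_h: "crd (h p y) k = crd y (p k)" if "p permutes {1..n}" "k \<le> n" for p y k
    using that permutes_zero[OF that(1)] permutes_pos[OF that(1), of k]
    by (auto simp: crd_def h_def)
  \<comment> \<open>The general \<open>q\<close> serves both inclusions: \<open>q = id\<close> for
    one, and for the other the inverse permutation applied to a point of
    \<open>Delta p\<close>.\<close>
  have h_in: "h p y \<in> Delta (q \<circ> p)" if pq: "p permutes {1..n}" "q permutes {1..n}" and y: "y \<in> Delta q" for p q y
  proof -
    have "h p y $ e k < 1" if k: "k \<in> {1..n}" for k
      using y permutes_in_image[OF pq(1), of k] k by (auto simp: Delta_def h_def)
    moreover have "crd (h p y) j < crd (h p y) k"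
      if "j \<le> n" "k \<le> n" "q (p j) < q (p k)" for j k
      using that Delta_less_iff[OF pq(2) y] permutes_le[OF pq(1)] crd_h[OF pq(1)] by simp
    ultimately show ?thesis
      by (simp add: Delta_def)
  qed
  have h_inv: "h p (h (inv p) y) = y" for y
  proof -
    have "idx (e (p (idx i))) = p (idx i)" for i
      by (rule idx_e) (use permutes_pos[OF p] permutes_le[OF p] in auto)
    then show ?thesis
      by (simp add: h_def vec_eq_iff permutes_inverses[OF p])
  qed
  have "Delta p = h p ` Delta id"
  proof (intro equalityI subsetI)
    fix y assume "y \<in> Delta p"
    then have "h (inv p) y \<in> Delta (p \<circ> inv p)"
      using permutes_inv[OF p] p by (intro h_in)
    then show "y \<in> h p ` Delta id"
      using h_inv permutes_inv_o(1)[OF p] by (metis image_eqI)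
  next
    fix y assume "y \<in> h p ` Delta id"
    then show "y \<in> Delta p"
      using h_in[OF p permutes_id] by auto
  qed
  moreover have "bij (\<lambda>i. e (p (idx i)))"
  proof -
    have "bij_betw (e \<circ> (p \<circ> idx)) UNIV UNIV"
      using bij_betw_inv_into[OF bij_e] permutes_imp_bij[OF p] bij_e
      unfolding idx_def by (intro bij_betw_trans)
    then show ?thesis by (simp add: o_def)
  qed
  ultimately show ?thesis
    using measure_permute_coordinates_image[OF _ lmeasurable_Delta[OF permutes_id]]
    by (simp add: h_def)
qed

text \<open>Off finitely many hyperplanes, a point of the cube has distinct coordinates strictly
  between 0 and 1; ranking them gives the permutation.\<close>

lemma negligible_cube_minus_Delta:
  "negligible (B_set e {} n - (\<Union>p\<in>{p. p permutes {1..n}}. Delta p))"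
proof (rule negligible_subset)
  let ?N = "(\<Union>k\<in>{1..n}. {y. axis (e k) 1 \<bullet> y = 0} \<union> {y. axis (e k) 1 \<bullet> y = 1}) \<union>
    (\<Union>(j, k)\<in>{1..n} \<times> {1..n} - Id. {y. (axis (e j) 1 - axis (e k) 1) \<bullet> y = 0}) :: (real^'n) set"
  have pair: "negligible {y. (axis (e j) 1 - axis (e k) 1) \<bullet> (y :: real^'n) = 0}"
    if "j \<in> {1..n}" "k \<in> {1..n}" "j \<noteq> k" for j k
  proof -
    have "e j \<noteq> e k"
      using that bij_betw_imp_inj_on[OF bij_e] by (auto dest: inj_onD)
    then have "axis (e j) 1 - axis (e k) 1 \<noteq> (0 :: real^'n)"
      by (simp add: axis_eq_axis)
    then show ?thesis
      by (intro negligible_hyperplane) simp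
  qed
  have "negligible {y. axis (e k) 1 \<bullet> (y :: real^'n) = c}" for k c
    by (intro negligible_hyperplane) simp
  then show "negligible ?N"
    by (intro negligible_Un negligible_Union) (auto intro!: negligible_Un pair)
  show "B_set e {} n - (\<Union>p\<in>{p. p permutes {1..n}}. Delta p) \<subseteq> ?N"
  proof (rule subsetI, rule ccontr)
    fix y assume y: "y \<in> B_set e {} n - (\<Union>p\<in>{p. p permutes {1..n}}. Delta p)" and "y \<notin> ?N"
    then have ne01: "y $ e k \<noteq> 0" "y $ e k \<noteq> 1" if "k \<in> {1..n}" for k
      using that by (auto simp: inner_axis')
    have ne: "y $ e j \<noteq> y $ e k" if "j \<in> {1..n}" "k \<in> {1..n}" "j \<noteq> k" for j k
      using that \<open>y \<notin> ?N\<close> by (auto simp: inner_axis' inner_diff_left)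
    have range: "0 < y $ e k \<and> y $ e k < 1" if "k \<in> {1..n}" for k
      using y ne01[OF that] that unfolding B_set_def
      by (metis (mono_tags, lifting) DiffD1 mem_Collect_eq order_le_less)
    obtain p where p: "p permutes {1..n}"
      "\<And>j k. j \<in> {1..n} \<Longrightarrow> k \<in> {1..n} \<Longrightarrow> y $ e j < y $ e k \<longleftrightarrow> p j < p k"
    proof (rule ex_permutes_rank[of n "\<lambda>j k. y $ e j < y $ e k"])
      fix j k assume "j \<in> {1..n}" "k \<in> {1..n}" "j \<noteq> k"
      then show "y $ e j < y $ e k \<or> y $ e k < y $ e j"
        using ne[of j k] by linarith
    qed auto
    have "crd y j < crd y k" if "j \<le> n" "k \<le> n" "p j < p k" for j k
    proof -
      have k: "k \<in> {1..n}"
        using that permutes_zero[OF p(1)] by (auto intro!: Suc_leI gr0I)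
      show ?thesis
        using p(2)[of j k] range[OF k] k that by (cases "j = 0") (auto simp: crd_def)
    qed
    then have "y \<in> Delta p"
      using range by (simp add: Delta_def)
    then show False
      using y p(1) by blast
  qed
qed

lemma measure_cube: "measure lebesgue (B_set e {} n) = 1"
proof -
  have "(0::real^'n) \<in> cbox 0 (\<chi> i. 1)"
    by (simp add: mem_box_cart)
  then have "cbox (0::real^'n) (\<chi> i. 1) \<noteq> {}"
    by blast
  then show ?thesis
    by (simp add: unit_cube_eq_cbox content_cbox_cart)
qed

text \<open>The \<open>fact n\<close> disjoint simplices have equal volume and fill the cube of
  volume 1 up to a null set.\<close>

lemma measure_Delta:
  assumes "p permutes {1..n}"
  shows "fact n * measure lebesgue (Delta p) = 1"
proof -
  let ?P = "{p. p permutes {1..n}}"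
  have fin: "finite ?P" and card: "card ?P = fact n"
    using finite_permutations[of "{1..n}"] card_permutations[of "{1..n}" n] by auto
  have "measure lebesgue (\<Union>p\<in>?P. Delta p) = (\<Sum>p\<in>?P. measure lebesgue (Delta p))"
  proof (rule measure_negligible_finite_Union_image[OF fin])
    show "pairwise (\<lambda>p q. negligible (Delta p \<inter> Delta q)) ?P"
      using Delta_disjoint by (auto simp: pairwise_def intro!: negligible_subset[OF negligible_empty])
  qed (simp add: lmeasurable_Delta)
  also have "\<dots> = (\<Sum>p\<in>?P. measure lebesgue (Delta id))"
    by (intro sum.cong refl measure_Delta_eq) simp
  also have "\<dots> = fact n * measure lebesgue (Delta p)"
    using measure_Delta_eq[OF assms] unfolding sum_constant card by simp
  also have "measure lebesgue (\<Union>p\<in>?P. Delta p) = measure lebesgue (B_set e {} n)"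
  proof (rule measure_negligible_symdiff)
    show "B_set e {} n \<in> lmeasurable"
      by (simp add: unit_cube_eq_cbox)
    have "(\<Union>p\<in>?P. Delta p) - B_set e {} n = {}"
      using Delta_subset_cube by blast
    then show "negligible (B_set e {} n - (\<Union>p\<in>?P. Delta p) \<union> ((\<Union>p\<in>?P. Delta p) - B_set e {} n))"
      using negligible_cube_minus_Delta by simp
  qed
  finally show ?thesis
    by (simp add: measure_cube)
qed

section \<open>Alcoves in arc-length coordinates\<close>

definition descents :: "(nat \<Rightarrow> nat) \<Rightarrow> real ^ 'n" where
  "descents p = (\<chi> i. of_bool (p (idx i) < p (idx i - 1)))"

text \<open>The step from point \<open>k - 1\<close> to point \<open>k\<close> passes the cut
  exactly when the rank drops, and then the arc length is the signed difference plus 1. So an alcove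
  is an integer translate of a simplex image.\<close>

definition alcove :: "(nat \<Rightarrow> nat) \<Rightarrow> (real ^ 'n) set" where
  "alcove p = (+) (descents p) ` diffv ` Delta p"

lemma lmeasurable_alcove: "p permutes {1..n} \<Longrightarrow> alcove p \<in> lmeasurable"
  unfolding alcove_def
  by (intro measurable_translation conjunct1[OF measure_diffv_image] bounded_Delta open_Delta)

lemma measure_alcove:
  "p permutes {1..n} \<Longrightarrow> measure lebesgue (alcove p) = measure lebesgue (Delta p)"
  unfolding alcove_def by (simp add: measure_translation measure_diffv_image bounded_Delta open_Delta)

lemma alcove_cases:
  assumes "x \<in> alcove p"
  obtains y where "y \<in> Delta p"
    "\<forall>k<n. x $ e (Suc k) = crd y (Suc k) - crd y k + of_bool (p (Suc k) < p k)"
proof -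
  obtain y where "y \<in> Delta p" "x = descents p + diffv y"
    using assms by (auto simp: alcove_def)
  then show thesis
    by (intro that[of y]) (simp_all add: descents_def diffv_def)
qed

lemma Delta_neq:
  assumes "p permutes {1..n}" "y \<in> Delta p" "j \<le> n" "k \<le> n" "j \<noteq> k"
  shows "crd y j \<noteq> crd y k"
proof -
  have "p j \<noteq> p k"
    using permutes_inj[OF assms(1)] assms(5) by (auto dest: injD)
  then show ?thesis
    using Delta_less_iff[OF assms(1,2)] assms(3,4) by (metis linorder_neqE_nat less_irrefl)
qed

text \<open>Two distinct positions in [0,1) differ by a nonzero number between -1 and 1, and 1 is
  added exactly when it is negative.\<close>

lemma alcove_component_range:
  assumes p: "p permutes {1..n}" and x: "x \<in> alcove p" and k: "k < n"
  shows "0 < x $ e (Suc k)" "x $ e (Suc k) < 1"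
proof -
  obtain y where y: "y \<in> Delta p"
    "\<forall>k<n. x $ e (Suc k) = crd y (Suc k) - crd y k + of_bool (p (Suc k) < p k)"
    using x by (rule alcove_cases)
  have "crd y k \<noteq> crd y (Suc k)"
    using k by (intro Delta_neq[OF p y(1)]) auto
  then show "0 < x $ e (Suc k)" "x $ e (Suc k) < 1"
    using k y(2)[rule_format, OF k] Delta_less_iff[OF p y(1), of "Suc k" k]
      Delta_range[OF p y(1), of k] Delta_range[OF p y(1), of "Suc k"]
    by (auto simp: of_bool_def split: if_splits)
qed

lemma alcove_subset_cube:
  assumes p: "p permutes {1..n}"
  shows "alcove p \<subseteq> B_set e {} n"
proof
  fix x assume x: "x \<in> alcove p"
  have "0 \<le> x $ e k \<and> x $ e k \<le> 1" if "k \<in> {1..n}" for k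
    using alcove_component_range[OF p x, of "k - 1"] that by (cases k) auto
  then show "x \<in> B_set e {} n"
    by (simp add: B_set_def)
qed

text \<open>The descents add only integers, so the fractional parts of the partial sums of
  \<open>x\<close> recover the positions, and these recover the permutation.\<close>

lemma alcove_disjoint:
  assumes p: "p permutes {1..n}" and q: "q permutes {1..n}" and x: "x \<in> alcove p" "x \<in> alcove q"
  shows "p = q"
proof -
  have frac: "frac (psum x k) = crd y k"
    if r: "r permutes {1..n}" and y: "y \<in> Delta r" and k: "k \<le> n" and
      x: "\<forall>k<n. x $ e (Suc k) = crd y (Suc k) - crd y k + of_bool (r (Suc k) < r k)"
    for r y k
  proof -
    have "psum x k - crd y k \<in> \<int>"
      using k
    proof (induction k)
      case (Suc k)
      have "psum x (Suc k) - crd y (Suc k) = (psum x k - crd y k) + of_bool (r (Suc k) < r k)"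
        using Suc.prems by (simp add: psum_Suc x)
      then show ?case
        using Suc by simp
    qed simp
    then show ?thesis
      using Delta_range[OF r y k] by (simp add: frac_unique_iff)
  qed
  obtain y where y: "y \<in> Delta p"
    "\<forall>k<n. x $ e (Suc k) = crd y (Suc k) - crd y k + of_bool (p (Suc k) < p k)"
    using x(1) by (rule alcove_cases)
  obtain z where z: "z \<in> Delta q"
    "\<forall>k<n. x $ e (Suc k) = crd z (Suc k) - crd z k + of_bool (q (Suc k) < q k)"
    using x(2) by (rule alcove_cases)
  have "crd y k = crd z k" if "k \<le> n" for k
    using frac[OF p y(1) that y(2)] frac[OF q z(1) that z(2)] by simp
  then show ?thesis
    using Delta_less_iff[OF p y(1)] Delta_less_iff[OF q z(1)]
    by (intro permutes_eqI_less[OF p q]) metis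
qed

text \<open>
  As long as the points \<open>i, i + 1, \<dots>, j\<close> form a chain, the partial sum from \<open>i\<close> to \<open>j\<close> is
  the length of the arc from \<open>y\<^sub>i\<close> to \<open>y\<^sub>j\<close> on the circle; the first time the chain
  condition fails, the walk has gone around the circle and the sum exceeds 1 forever.
\<close>

lemma alcove_sum_le_1_iff:
  assumes p: "p permutes {1..n}" and x: "x \<in> alcove p" and ij: "i < j" "j \<le> n"
  shows "psum x j - psum x i \<le> 1 \<longleftrightarrow> (\<forall>k. i < k \<and> k < j \<longrightarrow> cyc3 (p i) (p k) (p (Suc k)))"
proof -
  obtain y where y: "y \<in> Delta p"
    "\<forall>k<n. x $ e (Suc k) = crd y (Suc k) - crd y k + of_bool (p (Suc k) < p k)"
    using x by (rule alcove_cases)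
  note less = Delta_less_iff[OF p y(1)]
  note range = Delta_range[OF p y(1)]
  define chain where "chain j \<longleftrightarrow> (\<forall>k. i < k \<and> k < j \<longrightarrow> cyc3 (p i) (p k) (p (Suc k)))" for j
  \<comment> \<open>The chain case carries the exact arc length, since the bound alone does not
    determine the next sum. In the other case positive steps keep the sum above 1. At the start
    \<open>Suc i\<close> the chain condition is vacuous.\<close>
  have "(chain j \<longrightarrow> psum x j - psum x i = crd y j - crd y i + of_bool (p j < p i) \<and> psum x j - psum x i \<le> 1)
      \<and> (\<not> chain j \<longrightarrow> psum x j - psum x i > 1)"
    using Suc_leI[OF ij(1)] ij(2)
  proof (induction j rule: dec_induct)
    case base
    then have "i < n" by simp
    moreover have "chain (Suc i)" by (auto simp: chain_def)
    ultimately show ?case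
      using alcove_component_range[OF p x \<open>i < n\<close>] by (simp add: psum_Suc y(2))
  next
    case (step m)
    have chain_Suc: "chain (Suc m) \<longleftrightarrow> chain m \<and> cyc3 (p i) (p m) (p (Suc m))"
      using \<open>Suc i \<le> m\<close> by (auto simp: chain_def less_Suc_eq)
    have m: "m < n" "i \<le> n" using step by auto
    have ne: "crd y i \<noteq> crd y m" "crd y m \<noteq> crd y (Suc m)" "crd y i \<noteq> crd y (Suc m)"
      using Delta_neq[OF p y(1), of i m] Delta_neq[OF p y(1), of m "Suc m"]
        Delta_neq[OF p y(1), of i "Suc m"] \<open>Suc i \<le> m\<close> m by auto
    have ps: "psum x (Suc m) = psum x m + x $ e (Suc m)"
      by (rule psum_Suc)
    show ?case
    proof (cases "chain m")
      case False
      then show ?thesis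
        using step alcove_component_range[OF p x m(1)] chain_Suc ps by auto
    next
      case True
      then have eq: "psum x m - psum x i = crd y m - crd y i + of_bool (p m < p i)"
        using step by auto
      \<comment> \<open>Replacing ranks by positions leaves a case check on the order of three
        distinct reals in [0,1).\<close>
      have "cyc3 (p i) (p m) (p (Suc m)) \<longleftrightarrow> cyc3 (crd y i) (crd y m) (crd y (Suc m))"
        using m by (simp add: cyc3_def less)
      moreover have "psum x (Suc m) - psum x i = crd y (Suc m) - crd y i +
          of_bool (crd y m < crd y i) + of_bool (crd y (Suc m) < crd y m)"
        using eq ps y(2)[rule_format, OF m(1)] m by (simp add: less)
      moreover have "p (Suc m) < p i \<longleftrightarrow> crd y (Suc m) < crd y i"
        using m by (simp add: less)
      ultimately show ?thesis
        using True chain_Suc ne range[of i] range[of m] range[of "Suc m"] m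
        by (auto simp: cyc3_def of_bool_def)
    qed
  qed
  then show ?thesis
    unfolding chain_def by (metis not_le)
qed

section \<open>The volume formula by counting alcoves\<close>

lemma fact_measure_B_set:
  assumes I: "I \<subseteq> index_pairs n"
  shows "fact n * measure lebesgue (B_set e I n) = real (card (A_set I n))"
proof -
  let ?P = "{p. p permutes {1..n}}"
  define G where "G = {p. p permutes {1..n} \<and> cyc_of n p \<in> A_set I n}"
  have fin: "finite ?P" and card: "card ?P = fact n"
    using finite_permutations[of "{1..n}"] card_permutations[of "{1..n}" n] by auto
  have G: "G \<subseteq> ?P" and finG: "finite G"
    using fin by (auto simp: G_def intro: finite_subset)
  have meas: "measure lebesgue (\<Union>p\<in>Q. alcove p) = real (card Q) * measure lebesgue (Delta id)"
    if "Q \<subseteq> ?P" for Q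
  proof -
    have "measure lebesgue (\<Union>p\<in>Q. alcove p) = (\<Sum>p\<in>Q. measure lebesgue (alcove p))"
    proof (rule measure_negligible_finite_Union_image)
      show "finite Q"
        using that fin by (rule finite_subset)
      show "pairwise (\<lambda>p q. negligible (alcove p \<inter> alcove q)) Q"
      proof (rule pairwiseI)
        fix p q assume "p \<in> Q" "q \<in> Q" "p \<noteq> q"
        then have "alcove p \<inter> alcove q = {}"
          using alcove_disjoint that by blast
        then show "negligible (alcove p \<inter> alcove q)" by simp
      qed
    qed (use that lmeasurable_alcove in auto)
    also have "\<dots> = (\<Sum>p\<in>Q. measure lebesgue (Delta id))"
    proof (intro sum.cong refl)
      fix p assume "p \<in> Q"
      then have "p permutes {1..n}" using that by auto
      then show "measure lebesgue (alcove p) = measure lebesgue (Delta id)"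
        using measure_alcove measure_Delta_eq by metis
    qed
    finally show ?thesis by simp
  qed
  have fact_Delta: "fact n * measure lebesgue (Delta id) = 1"
    by (rule measure_Delta) (rule permutes_id)
  have meas_U: "(\<Union>p\<in>?P. alcove p) \<in> lmeasurable"
    using fin lmeasurable_alcove by (intro fmeasurable.finite_UN) auto
  \<comment> \<open>For the simplices, covering gave the volume; here the volume gives the covering:
    disjoint alcoves inside the cube have total volume 1.\<close>
  have neg: "negligible (B_set e {} n - (\<Union>p\<in>?P. alcove p))"
  proof -
    have "measure lebesgue (B_set e {} n - (\<Union>p\<in>?P. alcove p)) =
        measure lebesgue (B_set e {} n) - measure lebesgue (\<Union>p\<in>?P. alcove p)"
      using alcove_subset_cube meas_U
      by (intro measurable_measure_Diff) (auto simp: unit_cube_eq_cbox dest: fmeasurableD)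
    also have "\<dots> = 0"
      using meas[OF order_refl] fact_Delta unfolding card measure_cube by simp
    finally show ?thesis
      using meas_U by (auto simp: negligible_iff_measure unit_cube_eq_cbox intro!: fmeasurable.Diff)
  qed
  \<comment> \<open>The conditions for the pairs in \<open>I\<close> match one by one; the other
    constraints hold throughout an alcove because it lies in the cube.\<close>
  have A_iff: "cyc_of n p \<in> A_set I n \<longleftrightarrow> x \<in> B_set e I n" if p: "p permutes {1..n}" and x: "x \<in> alcove p" for p x
  proof -
    have "cyclic_chain_on {0..n} (cyc_of n p) [i..<Suc j] \<longleftrightarrow> psum x j - psum x i \<le> 1" if "(i, j) \<in> I" for i j
    proof -
      have "i < j" "j \<le> n"
        using that I by (auto simp: index_pairs_def)
      then show ?thesis
        using cyclic_chain_on_cyc_of_iff[OF p] alcove_sum_le_1_iff[OF p x] by simp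
    qed
    moreover have "x \<in> B_set e {} n"
      using x alcove_subset_cube[OF p] by blast
    ultimately show ?thesis
      unfolding A_set_def B_set_iff_psum[OF I] B_set_iff_psum[OF empty_subsetI]
      using total_cyclic_order_cyc_of[OF p] by fastforce
  qed
  have "measure lebesgue (B_set e I n) = measure lebesgue (\<Union>p\<in>G. alcove p)"
  proof (rule measure_negligible_symdiff)
    show "(\<Union>p\<in>G. alcove p) \<in> lmeasurable"
      using finG G lmeasurable_alcove by (intro fmeasurable.finite_UN) auto
    \<comment> \<open>On any alcove the two sets agree by \<open>A_iff\<close>, so they can differ
      only at points of the cube in no alcove.\<close>
    have "(\<Union>p\<in>G. alcove p) - B_set e I n \<union> (B_set e I n - (\<Union>p\<in>G. alcove p))
        \<subseteq> B_set e {} n - (\<Union>p\<in>?P. alcove p)"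
      using A_iff B_set_subset_cube[of I] unfolding G_def by blast
    then show "negligible ((\<Union>p\<in>G. alcove p) - B_set e I n \<union> (B_set e I n - (\<Union>p\<in>G. alcove p)))"
      by (rule negligible_subset[OF neg])
  qed
  then have "fact n * measure lebesgue (B_set e I n) = real (card G)"
    using meas[OF G] fact_Delta by simp
  moreover have "A_set I n = cyc_of n ` G"
  proof (intro equalityI subsetI)
    fix \<pi> assume \<pi>: "\<pi> \<in> A_set I n"
    then have "total_cyclic_order_on {0..n} \<pi>"
      by (simp add: A_set_def)
    then show "\<pi> \<in> cyc_of n ` G"
      using \<pi> by (auto simp: G_def elim!: ex_permutes_cyc_of)
  qed (auto simp: G_def)
  moreover have "inj_on (cyc_of n) G"
    using inj_on_cyc_of G by (rule inj_on_subset)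
  ultimately show ?thesis
    by (simp add: card_image)
qed

end

theorem theorem2p3:
  fixes n :: nat and e :: "nat \<Rightarrow> 'n::finite" and I :: "(nat \<times> nat) set"
  assumes "n \<ge> 1"
    and "CARD('n) = n"
    and "bij_betw e {1..n} UNIV"
    and "I \<subseteq> index_pairs n"
  shows "lattice_polytope (B_set e I n) \<and>
         fact n * measure lebesgue (B_set e I n) = real (card (A_set I n))"
proof -
  interpret coordinate_enumeration e n
    by standard fact
  have "index_pairs n \<subseteq> {0..n} \<times> {0..n}"
    by (auto simp: index_pairs_def)
  then have "finite I"
    using assms(4) by (meson finite_SigmaI finite_atLeastAtMost finite_subset)
  then show ?thesis
    using polytope_B_set extreme_point_B_set_integral fact_measure_B_set assms(4)
    by (auto simp: lattice_polytope_def)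
qed

end
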